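(* Let $(\Phi,M)$ and $(\Psi,N)$ be incarnations of data sets, $\Omega$ a basis of $(\Phi,M)$, and $\bar\alpha\colon\Omega\to\Psi$ and $T\colon M\to N$ functions. 1. Assume that for every relation $((g_1,\dots,g_k),(h_1,\dots,h_l))$ between any two (possibly equal) elements $\omega,\omega'$ in $\Omega$, the pair $((T(g_1),\dots,T(g_k)),(T(h_1),\dots,T(h_l)))$ is a relation between $\bar\alpha(\omega)$ and $\bar\alpha(\omega')$ in $\Psi$. Then there is a unique SEO $(\alpha,T)\colon(\Phi,M)\to(\Psi,N)$ for which the restriction of $\alpha\colon\Phi\to\Psi$ to $\Omega$ is $\bar\alpha$. 2. Assume $(\Phi,M)$ and $(\Psi,N)$ are monoid incarnations, $T$ is a monoid homomorphism, and if $\omega g=\omega'h$ for some $\omega,\omega'$ in $\Omega$ and $g,h$ in $M$, then $\bar\alpha(\omega)T(g)=\bar\alpha(\omega')T(h)$. Then there is a unique MEO $(\alpha,T)\colon(\Phi,M)\to(\Psi,N)$ for which the restriction of $\alpha$ to $\Omega$ is $\bar\alpha$. 3. Assume $(\Phi,M)$ and $(\Psi,N)$ are group incarnations, $T$ is a group homomorphism, and if $\omega=\omega g$ for some $\omega$ in $\Omega$ and $g$ in $M$, then $\bar\alpha(\omega)=\bar\alpha(\omega)T(g)$. Then there is a unique GEO $(\alpha,T)\colon(\Phi,M)\to(\Psi,N)$ for which the restriction of $\alpha$ to $\Omega$ is $\bar\alpha$.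
   Context: A data set is a finite set $\Phi=\{\phi_i\colon X\to\mathbf{R}\mid i=1,\dots,m\}$ of real-valued functions (measurements) on a finite set $X$. $\mathrm{End}_\Phi(X)$ is the monoid (under composition) of functions $g\colon X\to X$ such that $\phi g:=\phi\circ g\in\Phi$ for every $\phi\in\Phi$. An incarnation of $\Phi$ is a pair $(\Phi,M)$ with $M\subset\mathrm{End}_\Phi(X)$ a subset. It is a monoid incarnation if $M$ is a submonoid (containing the identity $\mathrm{id}_X$), and a group incarnation if moreover this submonoid is a group. A SEO (set equivariant operator) $(\alpha,T)\colon(\Phi,M)\to(\Psi,N)$ between incarnations is a pair of functions $\alpha\colon\Phi\to\Psi$ and $T\colon M\to N$ with $\alpha(\phi g)=\alpha(\phi)T(g)$ for all $\phi\in\Phi$, $g\in M$. A MEO is a SEO between monoid incarnations for which $T$ is a monoid homomorphism. A GEO is a MEO between group incarnations. For $\Omega\subset\Phi$, $\Omega M$ denotes the set of all measurements in $\Phi$ which either belong to $\Omega$ or are of the form $\omega g_1\cdots g_k$ for some $\omega\in\Omega$ and $g_1,\dots,g_k\in M$. Write $\phi M:=\{\phi\}M$. A subset $\Omega\subset\Phi$ is independent if $\omega\notin\omega'M$ for all $\omega\neq\omega'$ in $\Omega$. A basis of $(\Phi,M)$ is an independent subset $\Omega\subset\Phi$ with $\Omega M=\Phi$. A relation between measurements $\phi$ and $\psi$ in an incarnation $(\Phi,M)$ is a pair of finite sequences $((g_1,\dots,g_k),(h_1,\dots,h_l))$ of elements of $M$, with $k,l\ge0$ (empty sequences allowed, the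 empty product acting as the identity), for which $\phi g_1\cdots g_k=\psi h_1\cdots h_l$. *)

theory Defs
  imports Complex_Main "HOL-Algebra.Group"
begin

text \<open>
  A function defined on a set \<open>A\<close> is represented by an element of \<open>A \<rightarrow>\<^sub>E B\<close>, i.e. it
  takes the value \<^const>\<open>undefined\<close> outside \<open>A\<close>; so HOL equality of such functions is equality
  as functions on \<open>A\<close>, and \<open>\<exists>!\<close> has its usual meaning. Composition is \<^const>\<open>compose\<close>.
  The base set \<open>X\<close> is a set rather than a finite type, so it may be empty.
\<close>

definition data_set :: "'x set \<Rightarrow> ('x \<Rightarrow> real) set \<Rightarrow> bool" where
  "data_set X \<Phi> \<longleftrightarrow> finite X \<and> finite \<Phi> \<and> \<Phi> \<subseteq> (X \<rightarrow>\<^sub>E UNIV)"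

definition End_monoid :: "'x set \<Rightarrow> ('x \<Rightarrow> real) set \<Rightarrow> ('x \<Rightarrow> 'x) monoid" where
  "End_monoid X \<Phi> =
     \<lparr>carrier = {g \<in> X \<rightarrow>\<^sub>E X. \<forall>\<phi>\<in>\<Phi>. compose X \<phi> g \<in> \<Phi>},
      mult = compose X,
      one = (\<lambda>x\<in>X. x)\<rparr>"

lemma monoid_End_monoid:
  assumes "data_set X \<Phi>"
  shows "monoid (End_monoid X \<Phi>)"
proof -
  have ext: "\<phi> \<in> extensional X" if "\<phi> \<in> \<Phi>" for \<phi>
    using assms that by (auto simp: data_set_def PiE_def)
  have closed: "compose X g h \<in> carrier (End_monoid X \<Phi>)"
    if g: "g \<in> carrier (End_monoid X \<Phi>)" and h: "h \<in> carrier (End_monoid X \<Phi>)" for g h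
  proof -
    have gX: "g \<in> X \<rightarrow> X" and hX: "h \<in> X \<rightarrow> X"
      using g h by (auto simp: End_monoid_def)
    have "compose X \<phi> (compose X g h) \<in> \<Phi>" if "\<phi> \<in> \<Phi>" for \<phi>
      using compose_assoc[OF hX, of \<phi> g] g h that by (simp add: End_monoid_def)
    moreover have "compose X g h \<in> X \<rightarrow>\<^sub>E X"
      using funcset_compose[OF hX gX] by (simp add: PiE_def)
    ultimately show ?thesis
      by (simp add: End_monoid_def)
  qed
  have one: "compose X \<phi> (\<lambda>x\<in>X. x) = \<phi>" if "\<phi> \<in> \<Phi>" for \<phi>
    using ext[OF that] by (auto simp: compose_def extensional_def fun_eq_iff)
  show ?thesis
  proof (rule monoidI)
    show "\<one>\<^bsub>End_monoid X \<Phi>\<^esub> \<in> carrier (End_monoid X \<Phi>)"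
      using one by (auto simp: End_monoid_def)
  next
    fix f g h
    assume "h \<in> carrier (End_monoid X \<Phi>)"
    hence "h \<in> X \<rightarrow> X"
      by (auto simp: End_monoid_def)
    thus "f \<otimes>\<^bsub>End_monoid X \<Phi>\<^esub> g \<otimes>\<^bsub>End_monoid X \<Phi>\<^esub> h =
        f \<otimes>\<^bsub>End_monoid X \<Phi>\<^esub> (g \<otimes>\<^bsub>End_monoid X \<Phi>\<^esub> h)"
      using compose_assoc[of h X X f g] by (simp add: End_monoid_def)
  next
    fix g
    assume "g \<in> carrier (End_monoid X \<Phi>)"
    hence "g \<in> X \<rightarrow>\<^sub>E X"
      by (simp add: End_monoid_def)
    thus "\<one>\<^bsub>End_monoid X \<Phi>\<^esub> \<otimes>\<^bsub>End_monoid X \<Phi>\<^esub> g = g"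
      and "g \<otimes>\<^bsub>End_monoid X \<Phi>\<^esub> \<one>\<^bsub>End_monoid X \<Phi>\<^esub> = g"
      by (auto simp: End_monoid_def compose_def PiE_def extensional_def Pi_iff fun_eq_iff)
  qed (use closed in \<open>simp add: End_monoid_def\<close>)
qed

definition incarnation :: "'x set \<Rightarrow> ('x \<Rightarrow> real) set \<Rightarrow> ('x \<Rightarrow> 'x) set \<Rightarrow> bool" where
  "incarnation X \<Phi> M \<longleftrightarrow> data_set X \<Phi> \<and> M \<subseteq> carrier (End_monoid X \<Phi>)"

definition inc_monoid :: "'x set \<Rightarrow> ('x \<Rightarrow> real) set \<Rightarrow> ('x \<Rightarrow> 'x) set \<Rightarrow> ('x \<Rightarrow> 'x) monoid" where
  "inc_monoid X \<Phi> M = (End_monoid X \<Phi>)\<lparr>carrier := M\<rparr>"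

definition monoid_incarnation :: "'x set \<Rightarrow> ('x \<Rightarrow> real) set \<Rightarrow> ('x \<Rightarrow> 'x) set \<Rightarrow> bool" where
  "monoid_incarnation X \<Phi> M \<longleftrightarrow> incarnation X \<Phi> M \<and> submonoid M (End_monoid X \<Phi>)"

definition group_incarnation :: "'x set \<Rightarrow> ('x \<Rightarrow> real) set \<Rightarrow> ('x \<Rightarrow> 'x) set \<Rightarrow> bool" where
  "group_incarnation X \<Phi> M \<longleftrightarrow> monoid_incarnation X \<Phi> M \<and> group (inc_monoid X \<Phi> M)"

text \<open>\<^const>\<open>hom\<close> does not require preservation of the unit.\<close>

definition monoid_homs :: "('a, 'm) monoid_scheme \<Rightarrow> ('b, 'n) monoid_scheme \<Rightarrow> ('a \<Rightarrow> 'b) set" where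
  "monoid_homs G H = {T \<in> hom G H. T \<one>\<^bsub>G\<^esub> = \<one>\<^bsub>H\<^esub>}"

definition SEO ::
  "'x set \<Rightarrow> ('x \<Rightarrow> real) set \<Rightarrow> ('x \<Rightarrow> 'x) set \<Rightarrow>
   'y set \<Rightarrow> ('y \<Rightarrow> real) set \<Rightarrow> ('y \<Rightarrow> 'y) set \<Rightarrow>
   (('x \<Rightarrow> real) \<Rightarrow> ('y \<Rightarrow> real)) \<Rightarrow> (('x \<Rightarrow> 'x) \<Rightarrow> ('y \<Rightarrow> 'y)) \<Rightarrow> bool" where
  "SEO X \<Phi> M Y \<Psi> N \<alpha> T \<longleftrightarrow>
     incarnation X \<Phi> M \<and> incarnation Y \<Psi> N \<and>
     \<alpha> \<in> \<Phi> \<rightarrow>\<^sub>E \<Psi> \<and> T \<in> M \<rightarrow>\<^sub>E N \<and>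
     (\<forall>\<phi>\<in>\<Phi>. \<forall>g\<in>M. \<alpha> (compose X \<phi> g) = compose Y (\<alpha> \<phi>) (T g))"

definition MEO ::
  "'x set \<Rightarrow> ('x \<Rightarrow> real) set \<Rightarrow> ('x \<Rightarrow> 'x) set \<Rightarrow>
   'y set \<Rightarrow> ('y \<Rightarrow> real) set \<Rightarrow> ('y \<Rightarrow> 'y) set \<Rightarrow>
   (('x \<Rightarrow> real) \<Rightarrow> ('y \<Rightarrow> real)) \<Rightarrow> (('x \<Rightarrow> 'x) \<Rightarrow> ('y \<Rightarrow> 'y)) \<Rightarrow> bool" where
  "MEO X \<Phi> M Y \<Psi> N \<alpha> T \<longleftrightarrow>
     monoid_incarnation X \<Phi> M \<and> monoid_incarnation Y \<Psi> N \<and>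
     SEO X \<Phi> M Y \<Psi> N \<alpha> T \<and> T \<in> monoid_homs (inc_monoid X \<Phi> M) (inc_monoid Y \<Psi> N)"

definition GEO ::
  "'x set \<Rightarrow> ('x \<Rightarrow> real) set \<Rightarrow> ('x \<Rightarrow> 'x) set \<Rightarrow>
   'y set \<Rightarrow> ('y \<Rightarrow> real) set \<Rightarrow> ('y \<Rightarrow> 'y) set \<Rightarrow>
   (('x \<Rightarrow> real) \<Rightarrow> ('y \<Rightarrow> real)) \<Rightarrow> (('x \<Rightarrow> 'x) \<Rightarrow> ('y \<Rightarrow> 'y)) \<Rightarrow> bool" where
  "GEO X \<Phi> M Y \<Psi> N \<alpha> T \<longleftrightarrow>
     group_incarnation X \<Phi> M \<and> group_incarnation Y \<Psi> N \<and> MEO X \<Phi> M Y \<Psi> N \<alpha> T"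

text \<open>\<open>acts X \<phi> [g\<^sub>1, \<dots>, g\<^sub>k]\<close> is \<open>\<phi> g\<^sub>1 \<cdots> g\<^sub>k\<close>, and \<open>acts X \<phi> [] = \<phi>\<close>.\<close>

definition acts :: "'x set \<Rightarrow> ('x \<Rightarrow> real) \<Rightarrow> ('x \<Rightarrow> 'x) list \<Rightarrow> ('x \<Rightarrow> real)" where
  "acts X \<phi> gs = foldl (compose X) \<phi> gs"

text \<open>\<open>generated X \<Phi> M \<Omega>\<close> is the set written \<open>\<Omega>M\<close>.\<close>

definition generated ::
  "'x set \<Rightarrow> ('x \<Rightarrow> real) set \<Rightarrow> ('x \<Rightarrow> 'x) set \<Rightarrow> ('x \<Rightarrow> real) set \<Rightarrow> ('x \<Rightarrow> real) set" where
  "generated X \<Phi> M \<Omega> = {\<phi> \<in> \<Phi>. \<phi> \<in> \<Omega> \<or> (\<exists>\<omega>\<in>\<Omega>. \<exists>gs\<in>lists M. \<phi> = acts X \<omega> gs)}"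

definition meas_independent ::
  "'x set \<Rightarrow> ('x \<Rightarrow> real) set \<Rightarrow> ('x \<Rightarrow> 'x) set \<Rightarrow> ('x \<Rightarrow> real) set \<Rightarrow> bool" where
  "meas_independent X \<Phi> M \<Omega> \<longleftrightarrow>
     \<Omega> \<subseteq> \<Phi> \<and> (\<forall>\<omega>\<in>\<Omega>. \<forall>\<omega>'\<in>\<Omega>. \<omega> \<noteq> \<omega>' \<longrightarrow> \<omega> \<notin> generated X \<Phi> M {\<omega>'})"

definition meas_basis ::
  "'x set \<Rightarrow> ('x \<Rightarrow> real) set \<Rightarrow> ('x \<Rightarrow> 'x) set \<Rightarrow> ('x \<Rightarrow> real) set \<Rightarrow> bool" where
  "meas_basis X \<Phi> M \<Omega> \<longleftrightarrow> meas_independent X \<Phi> M \<Omega> \<and> generated X \<Phi> M \<Omega> = \<Phi>"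

definition relation_between ::
  "'x set \<Rightarrow> ('x \<Rightarrow> real) set \<Rightarrow> ('x \<Rightarrow> 'x) set \<Rightarrow> ('x \<Rightarrow> real) \<Rightarrow> ('x \<Rightarrow> real) \<Rightarrow>
   ('x \<Rightarrow> 'x) list \<times> ('x \<Rightarrow> 'x) list \<Rightarrow> bool" where
  "relation_between X \<Phi> M \<phi> \<psi> r \<longleftrightarrow>
     \<phi> \<in> \<Phi> \<and> \<psi> \<in> \<Phi> \<and> fst r \<in> lists M \<and> snd r \<in> lists M \<and>
     acts X \<phi> (fst r) = acts X \<psi> (snd r)"

end

theory Submission
  imports Defs
begin

text \<open>
  Every \<open>\<phi> \<in> \<Phi>\<close> has the form \<open>\<omega> g\<^sub>1 \<cdots> g\<^sub>k\<close> with \<open>\<omega> \<in> \<Omega>\<close>, and equivariance forces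
  \<open>\<alpha> \<phi> = \<alpha>0 \<omega> T(g\<^sub>1) \<cdots> T(g\<^sub>k)\<close>; the hypothesis on relations says that this is well defined. In
  the monoid case products collapse, so relations between single elements suffice. In the group
  case \<open>\<omega> g = \<omega>' h\<close> gives \<open>\<omega> = \<omega>' h g\<^sup>-\<^sup>1\<close>, hence \<open>\<omega> = \<omega>'\<close> by independence, and the stabilizer
  element \<open>k = h g\<^sup>-\<^sup>1\<close> satisfies \<open>k g = h\<close>.
\<close>

section \<open>Words in M acting on measurements\<close>

lemma acts_Nil [simp]: "acts X \<phi> [] = \<phi>"
  and acts_Cons [simp]: "acts X \<phi> (g # gs) = acts X (compose X \<phi> g) gs"
  and acts_snoc: "acts X \<phi> (gs @ [g]) = compose X (acts X \<phi> gs) g"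
  by (simp_all add: acts_def)

lemma incarnation_compose_in:
  assumes "incarnation X \<Phi> M" "\<phi> \<in> \<Phi>" "g \<in> M"
  shows "compose X \<phi> g \<in> \<Phi>"
  using assms by (auto simp: incarnation_def End_monoid_def)

lemma incarnation_funcset:
  assumes "incarnation X \<Phi> M" "g \<in> M"
  shows "g \<in> X \<rightarrow> X"
  using assms by (auto simp: incarnation_def End_monoid_def)

lemma acts_in:
  assumes "incarnation X \<Phi> M" "\<phi> \<in> \<Phi>" "gs \<in> lists M"
  shows "acts X \<phi> gs \<in> \<Phi>"
  using assms(3,2)
  by (induction gs arbitrary: \<phi>) (auto simp: incarnation_compose_in[OF assms(1)])

text \<open>On X both sides agree by evaluation; off X both are \<open>undefined\<close>, because
  measurements are extensional.\<close>

lemma compose_unit: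
  assumes "incarnation X \<Phi> M" "\<phi> \<in> \<Phi>"
  shows "compose X \<phi> \<one>\<^bsub>End_monoid X \<Phi>\<^esub> = \<phi>"
  using assms
  by (fastforce simp: incarnation_def data_set_def End_monoid_def compose_def PiE_def
      extensional_def fun_eq_iff)

text \<open>Turns the successive action of g and h into the action of their product. Since
  \<open>compose\<close> truncates to X, this rests on h mapping X into itself, so that the inner
  truncation never bites.\<close>

lemma compose_compose:
  assumes "incarnation X \<Phi> M" "h \<in> M"
  shows "compose X (compose X \<phi> g) h = compose X \<phi> (compose X g h)"
  using compose_assoc[OF incarnation_funcset[OF assms]] by metis

text \<open>Equivariance is applied letter by letter. The induction removes the first letter and
  restarts at \<phi>g, which lies in \<Phi> again, so \<phi> has to stay arbitrary.\<close>

lemma SEO_acts: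
  assumes "SEO X \<Phi> M Y \<Psi> N \<alpha> T" "\<phi> \<in> \<Phi>" "gs \<in> lists M"
  shows "\<alpha> (acts X \<phi> gs) = acts Y (\<alpha> \<phi>) (map T gs)"
  using assms(3,2)
proof (induction gs arbitrary: \<phi>)
  case (Cons g gs)
  then show ?case
    using assms(1) incarnation_compose_in[of X \<Phi> M \<phi> g] by (auto simp: SEO_def)
qed simp

lemma meas_basis_obtain:
  assumes "meas_basis X \<Phi> M \<Omega>" "\<phi> \<in> \<Phi>"
  obtains \<omega> gs where "\<omega> \<in> \<Omega>" "gs \<in> lists M" "\<phi> = acts X \<omega> gs"
proof -
  have "\<phi> \<in> generated X \<Phi> M \<Omega>"
    using assms by (simp add: meas_basis_def)
  then consider "\<phi> \<in> \<Omega>" | "\<exists>\<omega>\<in>\<Omega>. \<exists>gs\<in>lists M. \<phi> = acts X \<omega> gs"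
    by (auto simp: generated_def)
  then show thesis
    \<comment> \<open>A measurement of \<Omega> is presented by itself and the empty word, which
      merges the two clauses of \<open>generated\<close>.\<close>
    by cases (use that[of \<phi> "[]"] that in auto)
qed

lemma meas_basis_subset: "meas_basis X \<Phi> M \<Omega> \<Longrightarrow> \<Omega> \<subseteq> \<Phi>"
  by (simp add: meas_basis_def meas_independent_def)

section \<open>Uniqueness and existence of the equivariant extension\<close>

lemma SEO_unique:
  assumes "meas_basis X \<Phi> M \<Omega>"
    and \<alpha>: "SEO X \<Phi> M Y \<Psi> N \<alpha> T" and \<beta>: "SEO X \<Phi> M Y \<Psi> N \<beta> T"
    and eq: "restrict \<alpha> \<Omega> = restrict \<beta> \<Omega>"
  shows "\<alpha> = \<beta>"
proof (rule PiE_ext)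
  show "\<alpha> \<in> \<Phi> \<rightarrow>\<^sub>E \<Psi>" "\<beta> \<in> \<Phi> \<rightarrow>\<^sub>E \<Psi>"
    using \<alpha> \<beta> by (simp_all add: SEO_def)
  fix \<phi> assume "\<phi> \<in> \<Phi>"
  then obtain \<omega> gs where *: "\<omega> \<in> \<Omega>" "gs \<in> lists M" "\<phi> = acts X \<omega> gs"
    using meas_basis_obtain[OF assms(1)] by blast
  have "\<alpha> \<omega> = \<beta> \<omega>"
    using fun_cong[OF eq, of \<omega>] * by simp
  with * meas_basis_subset[OF assms(1)] show "\<alpha> \<phi> = \<beta> \<phi>"
    using SEO_acts[OF \<alpha>, of \<omega> gs] SEO_acts[OF \<beta>, of \<omega> gs] by auto
qed

lemma SEO_extension_exists:
  assumes X: "incarnation X \<Phi> M" and Y: "incarnation Y \<Psi> N"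
    and basis: "meas_basis X \<Phi> M \<Omega>"
    and \<alpha>0: "\<alpha>0 \<in> \<Omega> \<rightarrow>\<^sub>E \<Psi>" and T: "T \<in> M \<rightarrow>\<^sub>E N"
    and rel: "\<And>\<omega> \<omega>' gs hs. \<lbrakk>\<omega> \<in> \<Omega>; \<omega>' \<in> \<Omega>; gs \<in> lists M; hs \<in> lists M;
        acts X \<omega> gs = acts X \<omega>' hs\<rbrakk>
      \<Longrightarrow> acts Y (\<alpha>0 \<omega>) (map T gs) = acts Y (\<alpha>0 \<omega>') (map T hs)"
  shows "\<exists>\<alpha>. SEO X \<Phi> M Y \<Psi> N \<alpha> T \<and> restrict \<alpha> \<Omega> = \<alpha>0"
proof -
  \<comment> \<open>Any one presentation of \<phi> supplies the value \<psi>, and \<open>rel\<close>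
    makes every other presentation give the same value. Choosing such a \<psi> for each \<phi> then
    yields \<beta>.\<close>
  have "\<exists>\<psi>. \<forall>\<omega>\<in>\<Omega>. \<forall>gs\<in>lists M. \<phi> = acts X \<omega> gs \<longrightarrow> \<psi> = acts Y (\<alpha>0 \<omega>) (map T gs)"
    if "\<phi> \<in> \<Phi>" for \<phi>
    using meas_basis_obtain[OF basis that] rel by metis
  then obtain \<beta> where \<beta>: "\<beta> (acts X \<omega> gs) = acts Y (\<alpha>0 \<omega>) (map T gs)"
    if "acts X \<omega> gs \<in> \<Phi>" "\<omega> \<in> \<Omega>" "gs \<in> lists M" for \<omega> gs
    by metis
  have sub: "\<Omega> \<subseteq> \<Phi>"
    using basis by (rule meas_basis_subset)
  \<comment> \<open>The choice says nothing about \<beta> off \<Phi>; truncating makes the map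
    extensional, as \<open>SEO\<close> demands.\<close>
  define \<alpha> where "\<alpha> = restrict \<beta> \<Phi>"
  have \<alpha>: "\<alpha> (acts X \<omega> gs) = acts Y (\<alpha>0 \<omega>) (map T gs)" if "\<omega> \<in> \<Omega>" "gs \<in> lists M" for \<omega> gs
    using \<beta>[of \<omega> gs] acts_in[OF X, of \<omega> gs] that sub by (auto simp: \<alpha>_def)
  have map_T: "map T gs \<in> lists N" if "gs \<in> lists M" for gs
    using that PiE_mem[OF T] by auto
  have "\<alpha> \<phi> \<in> \<Psi> \<and> (\<forall>g\<in>M. \<alpha> (compose X \<phi> g) = compose Y (\<alpha> \<phi>) (T g))" if \<phi>: "\<phi> \<in> \<Phi>" for \<phi>
  proof -
    obtain \<omega> gs where *: "\<omega> \<in> \<Omega>" "gs \<in> lists M" "\<phi> = acts X \<omega> gs"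
      using meas_basis_obtain[OF basis \<phi>] by blast
    have "\<alpha> \<phi> \<in> \<Psi>"
      using \<alpha>[OF *(1,2)] acts_in[OF Y _ map_T[OF *(2)], of "\<alpha>0 \<omega>"] * \<alpha>0 by auto
    \<comment> \<open>If \<omega> and gs present \<phi>, then \<omega> and the word with g appended
      at the end present \<phi>g; both values are read off the same formula.\<close>
    moreover have "\<alpha> (compose X \<phi> g) = compose Y (\<alpha> \<phi>) (T g)" if "g \<in> M" for g
      using \<alpha>[of \<omega> "gs @ [g]"] \<alpha>[of \<omega> gs] * that by (simp add: acts_snoc)
    ultimately show ?thesis by blast
  qed
  moreover have "\<alpha> \<in> extensional \<Phi>"
    by (simp add: \<alpha>_def)
  ultimately have "SEO X \<Phi> M Y \<Psi> N \<alpha> T"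
    using X Y T by (auto simp: SEO_def PiE_def)
  moreover have "restrict \<alpha> \<Omega> = \<alpha>0"
  proof (rule extensionalityI[where A = \<Omega>])
    show "\<alpha>0 \<in> extensional \<Omega>" using \<alpha>0 by (simp add: PiE_def)
    \<comment> \<open>The empty word presents \<omega>.\<close>
    show "restrict \<alpha> \<Omega> \<omega> = \<alpha>0 \<omega>" if "\<omega> \<in> \<Omega>" for \<omega>
      using \<alpha>[OF that, of "[]"] that by simp
  qed simp
  ultimately show ?thesis by blast
qed

lemma SEO_extension_ex1:
  assumes "incarnation X \<Phi> M" "incarnation Y \<Psi> N" "meas_basis X \<Phi> M \<Omega>"
    and "\<alpha>0 \<in> \<Omega> \<rightarrow>\<^sub>E \<Psi>" "T \<in> M \<rightarrow>\<^sub>E N"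
    and "\<And>\<omega> \<omega>' gs hs. \<lbrakk>\<omega> \<in> \<Omega>; \<omega>' \<in> \<Omega>; gs \<in> lists M; hs \<in> lists M;
        acts X \<omega> gs = acts X \<omega>' hs\<rbrakk>
      \<Longrightarrow> acts Y (\<alpha>0 \<omega>) (map T gs) = acts Y (\<alpha>0 \<omega>') (map T hs)"
  shows "\<exists>!\<alpha>. SEO X \<Phi> M Y \<Psi> N \<alpha> T \<and> restrict \<alpha> \<Omega> = \<alpha>0"
proof (rule ex_ex1I)
  show "\<exists>\<alpha>. SEO X \<Phi> M Y \<Psi> N \<alpha> T \<and> restrict \<alpha> \<Omega> = \<alpha>0"
    using assms by (rule SEO_extension_exists)
qed (use SEO_unique[OF assms(3)] in metis)

text \<open>The witness g is the product of the word. Because T is a monoid homomorphism, T g is the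
  product of the image word, so a single g collapses both actions, uniformly in the measurements.
  This reduces relations between words to relations between single elements.\<close>

lemma monoid_incarnation_acts_eq:
  assumes X: "monoid_incarnation X \<Phi> M" and Y: "monoid_incarnation Y \<Psi> N"
    and T: "T \<in> monoid_homs (inc_monoid X \<Phi> M) (inc_monoid Y \<Psi> N)"
    and "gs \<in> lists M"
  shows "\<exists>g\<in>M. (\<forall>\<phi>\<in>\<Phi>. acts X \<phi> gs = compose X \<phi> g) \<and>
    (\<forall>\<psi>\<in>\<Psi>. acts Y \<psi> (map T gs) = compose Y \<psi> (T g))"
  using assms(4)
proof (induction gs)
  case Nil
  \<comment> \<open>The empty word collapses to the identity, so its image must be the identity of
    N: preservation of the unit enters here.\<close>
  have "\<one>\<^bsub>End_monoid X \<Phi>\<^esub> \<in> M" "T \<one>\<^bsub>End_monoid X \<Phi>\<^esub> = \<one>\<^bsub>End_monoid Y \<Psi>\<^esub>"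
    using X T by (auto simp: monoid_incarnation_def monoid_homs_def inc_monoid_def
        intro: submonoid.one_closed)
  with X Y show ?case
    by (intro bexI[of _ "\<one>\<^bsub>End_monoid X \<Phi>\<^esub>"]) (auto simp: monoid_incarnation_def compose_unit)
next
  case (Cons g gs)
  then obtain h where h: "h \<in> M" "\<And>\<phi>. \<phi> \<in> \<Phi> \<Longrightarrow> acts X \<phi> gs = compose X \<phi> h"
      "\<And>\<psi>. \<psi> \<in> \<Psi> \<Longrightarrow> acts Y \<psi> (map T gs) = compose Y \<psi> (T h)"
    by auto
  have XY: "incarnation X \<Phi> M" "incarnation Y \<Psi> N"
    using X Y by (auto simp: monoid_incarnation_def)
  have TN: "T k \<in> N" if "k \<in> M" for k
    using T that by (auto simp: monoid_homs_def hom_def inc_monoid_def)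
  have "g \<in> M"
    using Cons by simp
  moreover have "compose X g h \<in> M"
    using X submonoid.m_closed[of M "End_monoid X \<Phi>" g h] \<open>g \<in> M\<close> h(1)
    by (auto simp: monoid_incarnation_def End_monoid_def)
  moreover have "T (compose X g h) = compose Y (T g) (T h)"
    using T \<open>g \<in> M\<close> h(1) by (auto simp: monoid_homs_def hom_def inc_monoid_def End_monoid_def)
  \<comment> \<open>The induction hypothesis is applied to \<phi>g on one side and to \<psi> acted
    on by T g on the other; associativity then merges g with h, and T g with T h.\<close>
  ultimately show ?case
    using h TN[of g] TN[of h] XY
    by (intro bexI[of _ "compose X g h"])
       (auto simp: compose_compose incarnation_compose_in)
qed

lemma MEO_extension_ex1:
  assumes X: "monoid_incarnation X \<Phi> M" and Y: "monoid_incarnation Y \<Psi> N"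
    and basis: "meas_basis X \<Phi> M \<Omega>"
    and \<alpha>0: "\<alpha>0 \<in> \<Omega> \<rightarrow>\<^sub>E \<Psi>" and T: "T \<in> M \<rightarrow>\<^sub>E N"
    and hom: "T \<in> monoid_homs (inc_monoid X \<Phi> M) (inc_monoid Y \<Psi> N)"
    and rel: "\<And>\<omega> \<omega>' g h. \<lbrakk>\<omega> \<in> \<Omega>; \<omega>' \<in> \<Omega>; g \<in> M; h \<in> M; compose X \<omega> g = compose X \<omega>' h\<rbrakk>
      \<Longrightarrow> compose Y (\<alpha>0 \<omega>) (T g) = compose Y (\<alpha>0 \<omega>') (T h)"
  shows "\<exists>!\<alpha>. MEO X \<Phi> M Y \<Psi> N \<alpha> T \<and> restrict \<alpha> \<Omega> = \<alpha>0"
proof -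
  have "\<exists>!\<alpha>. SEO X \<Phi> M Y \<Psi> N \<alpha> T \<and> restrict \<alpha> \<Omega> = \<alpha>0"
  proof (rule SEO_extension_ex1[OF _ _ basis \<alpha>0 T])
    show "incarnation X \<Phi> M" "incarnation Y \<Psi> N"
      using X Y by (simp_all add: monoid_incarnation_def)
    fix \<omega> \<omega>' gs hs
    assume *: "\<omega> \<in> \<Omega>" "\<omega>' \<in> \<Omega>" "gs \<in> lists M" "hs \<in> lists M" "acts X \<omega> gs = acts X \<omega>' hs"
    obtain g where g: "g \<in> M" "\<forall>\<phi>\<in>\<Phi>. acts X \<phi> gs = compose X \<phi> g"
        "\<forall>\<psi>\<in>\<Psi>. acts Y \<psi> (map T gs) = compose Y \<psi> (T g)"
      using monoid_incarnation_acts_eq[OF X Y hom *(3)] by blast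
    obtain h where h: "h \<in> M" "\<forall>\<phi>\<in>\<Phi>. acts X \<phi> hs = compose X \<phi> h"
        "\<forall>\<psi>\<in>\<Psi>. acts Y \<psi> (map T hs) = compose Y \<psi> (T h)"
      using monoid_incarnation_acts_eq[OF X Y hom *(4)] by blast
    have "\<omega> \<in> \<Phi>" "\<omega>' \<in> \<Phi>" "\<alpha>0 \<omega> \<in> \<Psi>" "\<alpha>0 \<omega>' \<in> \<Psi>"
      using * meas_basis_subset[OF basis] \<alpha>0 by auto
    with g h * rel[of \<omega> \<omega>' g h]
    show "acts Y (\<alpha>0 \<omega>) (map T gs) = acts Y (\<alpha>0 \<omega>') (map T hs)"
      by simp
  qed
  \<comment> \<open>With the incarnations and T fixed, being a MEO differs from being a SEO only by
    conditions free of \<alpha>, so unique existence carries over.\<close>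
  with X Y hom show ?thesis
    by (simp add: MEO_def)
qed

text \<open>The witness is the quotient k = h i, with i the inverse of g. Acting with i on both
  sides of \<phi>g = \<psi>h isolates \<phi>.\<close>

lemma group_incarnation_divide:
  assumes "group_incarnation X \<Phi> M" "g \<in> M" "h \<in> M"
  obtains k where "k \<in> M" "compose X k g = h"
    "\<And>\<phi> \<psi>. \<lbrakk>\<phi> \<in> \<Phi>; \<psi> \<in> \<Phi>; compose X \<phi> g = compose X \<psi> h\<rbrakk> \<Longrightarrow> \<phi> = compose X \<psi> k"
proof -
  let ?G = "inc_monoid X \<Phi> M"
  interpret group ?G
    using assms(1) by (simp add: group_incarnation_def)
  have inc: "incarnation X \<Phi> M"
    using assms(1) by (simp add: group_incarnation_def monoid_incarnation_def)
  \<comment> \<open>Shrinking the carrier keeps the unit, so the neutral element of the group is the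
    identity of X and fixes every measurement.\<close>
  have [simp]: "carrier ?G = M" "mult ?G = compose X" "one ?G = one (End_monoid X \<Phi>)"
    by (simp_all add: inc_monoid_def End_monoid_def)
  define i where "i = inv\<^bsub>?G\<^esub> g"
  have i: "i \<in> M" "compose X i g = \<one>\<^bsub>End_monoid X \<Phi>\<^esub>" "compose X g i = \<one>\<^bsub>End_monoid X \<Phi>\<^esub>"
    using inv_closed[of g] l_inv[of g] r_inv[of g] assms(2) by (simp_all add: i_def)
  show thesis
  proof (rule that)
    show "compose X h i \<in> M"
      using m_closed[of h i] assms i by simp
    show "compose X (compose X h i) g = h"
      using m_assoc[of h i g] r_one[of h] assms i by simp
    fix \<phi> \<psi> assume "\<phi> \<in> \<Phi>" "\<psi> \<in> \<Phi>" and eq: "compose X \<phi> g = compose X \<psi> h"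
    have "\<phi> = compose X (compose X \<phi> g) i"
      using compose_unit[OF inc \<open>\<phi> \<in> \<Phi>\<close>] i(3) compose_compose[OF inc i(1)] by metis
    then show "\<phi> = compose X \<psi> (compose X h i)"
      using compose_compose[OF inc i(1)] eq by metis
  qed
qed

section \<open>Group incarnations: from stabilizers to relations\<close>

lemma GEO_extension_ex1:
  assumes X: "group_incarnation X \<Phi> M" and Y: "group_incarnation Y \<Psi> N"
    and basis: "meas_basis X \<Phi> M \<Omega>"
    and \<alpha>0: "\<alpha>0 \<in> \<Omega> \<rightarrow>\<^sub>E \<Psi>" and T: "T \<in> M \<rightarrow>\<^sub>E N"
    and hom: "T \<in> hom (inc_monoid X \<Phi> M) (inc_monoid Y \<Psi> N)"
    and stab: "\<And>\<omega> g. \<lbrakk>\<omega> \<in> \<Omega>; g \<in> M; \<omega> = compose X \<omega> g\<rbrakk> \<Longrightarrow> \<alpha>0 \<omega> = compose Y (\<alpha>0 \<omega>) (T g)"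
  shows "\<exists>!\<alpha>. GEO X \<Phi> M Y \<Psi> N \<alpha> T \<and> restrict \<alpha> \<Omega> = \<alpha>0"
proof -
  have inc: "incarnation Y \<Psi> N"
    using Y by (simp add: group_incarnation_def monoid_incarnation_def)
  have "\<exists>!\<alpha>. MEO X \<Phi> M Y \<Psi> N \<alpha> T \<and> restrict \<alpha> \<Omega> = \<alpha>0"
  proof (rule MEO_extension_ex1[OF _ _ basis \<alpha>0 T])
    show "monoid_incarnation X \<Phi> M" "monoid_incarnation Y \<Psi> N"
      using X Y by (simp_all add: group_incarnation_def)
    \<comment> \<open>Between groups, multiplicativity already forces the unit to be
      preserved.\<close>
    show "T \<in> monoid_homs (inc_monoid X \<Phi> M) (inc_monoid Y \<Psi> N)"
      using hom_one[OF hom] hom X Y by (simp add: monoid_homs_def group_incarnation_def)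
    fix \<omega> \<omega>' g h
    assume *: "\<omega> \<in> \<Omega>" "\<omega>' \<in> \<Omega>" "g \<in> M" "h \<in> M" "compose X \<omega> g = compose X \<omega>' h"
    have \<Phi>: "\<omega> \<in> \<Phi>" "\<omega>' \<in> \<Phi>"
      using * meas_basis_subset[OF basis] by auto
    obtain k where k: "k \<in> M" "compose X k g = h" "\<omega> = compose X \<omega>' k"
      using group_incarnation_divide[OF X *(3,4)] \<Phi> *(5) by metis
    \<comment> \<open>The one-letter word k places \<omega> in \<omega>'M, which independence
      permits only for \<omega> = \<omega>'. Hence k stabilizes \<omega>.\<close>
    then have "\<omega> = acts X \<omega>' [k]" "[k] \<in> lists M"
      by simp_all
    then have "\<omega> \<in> generated X \<Phi> M {\<omega>'}"
      using \<Phi> unfolding generated_def by blast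
    then have eq: "\<omega> = \<omega>'"
      using basis * by (auto simp: meas_basis_def meas_independent_def)
    \<comment> \<open>Applying T to h = kg splits off T k, which \<open>stab\<close> lets \<alpha>0
      \<omega> absorb.\<close>
    have "T h = compose Y (T k) (T g)"
      using hom k *(3) by (auto simp: hom_def inc_monoid_def End_monoid_def)
    then have "compose Y (\<alpha>0 \<omega>) (T h) = compose Y (compose Y (\<alpha>0 \<omega>) (T k)) (T g)"
      using PiE_mem[OF T *(3)] by (simp add: compose_compose[OF inc])
    also have "compose Y (\<alpha>0 \<omega>) (T k) = \<alpha>0 \<omega>"
      using stab[OF *(1) k(1)] k(3) eq by simp
    finally show "compose Y (\<alpha>0 \<omega>) (T g) = compose Y (\<alpha>0 \<omega>') (T h)"
      by (simp add: eq)
  qed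
  with X Y show ?thesis
    by (simp add: GEO_def)
qed

theorem proposition5:
  fixes X :: "'x set" and \<Phi> \<Omega> :: "('x \<Rightarrow> real) set" and M :: "('x \<Rightarrow> 'x) set"
    and Y :: "'y set" and \<Psi> :: "('y \<Rightarrow> real) set" and N :: "('y \<Rightarrow> 'y) set"
    and \<alpha>0 :: "('x \<Rightarrow> real) \<Rightarrow> ('y \<Rightarrow> real)" and T :: "('x \<Rightarrow> 'x) \<Rightarrow> ('y \<Rightarrow> 'y)"
  assumes "incarnation X \<Phi> M" and "incarnation Y \<Psi> N"
    and "meas_basis X \<Phi> M \<Omega>"
    and "\<alpha>0 \<in> \<Omega> \<rightarrow>\<^sub>E \<Psi>" and "T \<in> M \<rightarrow>\<^sub>E N"
  shows
    "((\<forall>\<omega>\<in>\<Omega>. \<forall>\<omega>'\<in>\<Omega>. \<forall>gs hs. relation_between X \<Phi> M \<omega> \<omega>' (gs, hs) \<longrightarrow>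
          relation_between Y \<Psi> N (\<alpha>0 \<omega>) (\<alpha>0 \<omega>') (map T gs, map T hs))
        \<longrightarrow> (\<exists>!\<alpha>. SEO X \<Phi> M Y \<Psi> N \<alpha> T \<and> restrict \<alpha> \<Omega> = \<alpha>0)) \<and>
     (monoid_incarnation X \<Phi> M \<and> monoid_incarnation Y \<Psi> N \<and>
      T \<in> monoid_homs (inc_monoid X \<Phi> M) (inc_monoid Y \<Psi> N) \<and>
      (\<forall>\<omega>\<in>\<Omega>. \<forall>\<omega>'\<in>\<Omega>. \<forall>g\<in>M. \<forall>h\<in>M. compose X \<omega> g = compose X \<omega>' h \<longrightarrow>
          compose Y (\<alpha>0 \<omega>) (T g) = compose Y (\<alpha>0 \<omega>') (T h))
        \<longrightarrow> (\<exists>!\<alpha>. MEO X \<Phi> M Y \<Psi> N \<alpha> T \<and> restrict \<alpha> \<Omega> = \<alpha>0)) \<and>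
     (group_incarnation X \<Phi> M \<and> group_incarnation Y \<Psi> N \<and>
      T \<in> hom (inc_monoid X \<Phi> M) (inc_monoid Y \<Psi> N) \<and>
      (\<forall>\<omega>\<in>\<Omega>. \<forall>g\<in>M. \<omega> = compose X \<omega> g \<longrightarrow> \<alpha>0 \<omega> = compose Y (\<alpha>0 \<omega>) (T g))
        \<longrightarrow> (\<exists>!\<alpha>. GEO X \<Phi> M Y \<Psi> N \<alpha> T \<and> restrict \<alpha> \<Omega> = \<alpha>0))" (is "(?rel \<longrightarrow> ?SEO) \<and> (?mon \<longrightarrow> ?MEO) \<and> (?grp \<longrightarrow> ?GEO)")
proof (intro conjI)
  show "?rel \<longrightarrow> ?SEO"
  proof
    assume rel: ?rel
    show ?SEO
    proof (rule SEO_extension_ex1[OF assms])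
      fix \<omega> \<omega>' gs hs
      assume *: "\<omega> \<in> \<Omega>" "\<omega>' \<in> \<Omega>" "gs \<in> lists M" "hs \<in> lists M" "acts X \<omega> gs = acts X \<omega>' hs"
      \<comment> \<open>Besides the equation, a relation asks for membership in \<Phi>, which holds
        as the basis lies in \<Phi>.\<close>
      then have "relation_between X \<Phi> M \<omega> \<omega>' (gs, hs)"
        using meas_basis_subset[OF assms(3)] by (auto simp: relation_between_def)
      with rel *(1,2) have "relation_between Y \<Psi> N (\<alpha>0 \<omega>) (\<alpha>0 \<omega>') (map T gs, map T hs)"
        by blast
      then show "acts Y (\<alpha>0 \<omega>) (map T gs) = acts Y (\<alpha>0 \<omega>') (map T hs)"
        by (simp add: relation_between_def)
    qed
  qed
  show "?mon \<longrightarrow> ?MEO"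
  proof
    assume mon: ?mon
    show ?MEO
    proof (rule MEO_extension_ex1[OF _ _ assms(3-5)])
      show "monoid_incarnation X \<Phi> M" "monoid_incarnation Y \<Psi> N"
        and "T \<in> monoid_homs (inc_monoid X \<Phi> M) (inc_monoid Y \<Psi> N)"
        using mon by blast+
    qed (use mon in metis)
  qed
  show "?grp \<longrightarrow> ?GEO"
  proof
    assume grp: ?grp
    show ?GEO
    proof (rule GEO_extension_ex1[OF _ _ assms(3-5)])
      show "group_incarnation X \<Phi> M" "group_incarnation Y \<Psi> N"
        and "T \<in> hom (inc_monoid X \<Phi> M) (inc_monoid Y \<Psi> N)"
        using grp by blast+
    qed (use grp in metis)
  qed
qed

end
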